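(* Let $\alpha>0$, let $A$ be a purchase process, and let $A'$ be a process with $A'(t)\overset{d}{=}\alpha A(t)$ (equality in law as processes in $t$). Let $$B_\ell(t)=\sup_{0\le u\le t}\{A(u):A(u)\le \ell\}\quad\text{and}\quad B'_\ell(t)=\sup_{0\le u\le t}\{A'(u):A'(u)\le \ell\}.$$ Then the solution to the optimisation problem $$\hat\ell'=\operatorname*{arg\,max}_{\ell\in\Lambda}\bigl(\gamma\,\mathbf{E}[B'_\ell(t)]-\nu\ell\bigr)$$ satisfies $$\hat\ell'=\alpha\operatorname*{arg\,max}_{\ell\in\Lambda}\bigl(\gamma\,\mathbf{E}[B_\ell(t)]-\nu\ell\bigr)=\alpha\hat\ell,$$ as long as $\alpha\hat\ell\in\Lambda$, where $\hat\ell=\operatorname*{arg\,max}_{\ell\in\Lambda}\bigl(\gamma\,\mathbf{E}[B_\ell(t)]-\nu\ell\bigr)$. Furthermore, $$\mathbf{P}\bigl(A'(t)>\hat\ell'\bigr)=\mathbf{P}\bigl(A(t)>\hat\ell\bigr).$$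
   Context: The purchase process is a marked point process $A(t)=\sum_{i=1}^{N(t)}\xi_i$, where $(\xi_i)_{i\ge1}$ are non-negative independent random variables with common distribution function $F$, and $N(t)$, independent of $(\xi_i)_{i\ge1}$, is the number of events in $(0,t]$ of a renewal process with inter-event time distribution $G$; $F$ and $G$ are of exponential order with all moments finite, and their Laplace transforms have strictly negative abscissae of convergence. $B_\ell(t)$ is the outstanding balance at time $t$ under credit limit $\ell>0$ when the balance is frozen at the first attempted purchase that would take it above $\ell$. The time $t>0$ is fixed (the statement period length), $\gamma>0$ is the interchange rate, $\nu>0$ is the proportional cost of funding the limit, and $\Lambda\subseteq(0,\infty)$ is the set of permitted limits. The notation $\operatorname{arg\,max}$ denotes the maximiser, treated as existing and unique.
   Formalization: Adds the condition that each ℓ in Λ has ℓ/α in Λ or a strictly smaller objective for A at ℓ/α than at the maximiser (the claim fails without it, e.g. Λ=[6,12], α=2); A' is taken a.s. right-continuous with B'_ℓ(t) measurable. *)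

theory Defs
  imports "HOL-Probability.Probability"
begin

section \<open>Laplace transforms and admissible distribution functions\<close>

definition laplace_abscissa :: "(real \<Rightarrow> real) \<Rightarrow> ereal" where
  "laplace_abscissa F =
     Inf {ereal s | s. integrable (interval_measure F) (\<lambda>x. exp (- s * x))}"

text \<open>For a bounded function such as a distribution function the first clause is automatic.\<close>

definition admissible_df :: "(real \<Rightarrow> real) \<Rightarrow> bool" where
  "admissible_df F \<longleftrightarrow>
     (\<exists>c. F \<in> O[at_top](\<lambda>x. exp (c * x))) \<and>
     (\<forall>k::nat. integrable (interval_measure F) (\<lambda>x. x ^ k)) \<and>
     laplace_abscissa F < 0"

section \<open>Purchase processes\<close>

definition iid_nonneg ::
  "'a measure \<Rightarrow> (real \<Rightarrow> real) \<Rightarrow> (nat \<Rightarrow> 'a \<Rightarrow> real) \<Rightarrow> bool" where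
  "iid_nonneg M F X \<longleftrightarrow>
     prob_space.indep_vars M (\<lambda>_. borel) X UNIV \<and>
     (\<forall>i. cdf (distr M borel (X i)) = F) \<and>
     (\<forall>i. \<forall>\<omega>\<in>space M. 0 \<le> X i \<omega>)"

text \<open>
  Sequences are indexed from 0, so the \<open>n\<close>-th partial sum below is the epoch of the
  \<open>(n + 1)\<close>-st event. Infinitely many events in \<open>(0, u]\<close> (which has probability 0) would
  be counted as 0 by \<^const>\<open>card\<close>.
\<close>

definition renewal_count :: "(nat \<Rightarrow> 'a \<Rightarrow> real) \<Rightarrow> real \<Rightarrow> 'a \<Rightarrow> nat" where
  "renewal_count T u \<omega> = card {n. (\<Sum>i\<le>n. T i \<omega>) \<in> {0<..u}}"

text \<open>
  Independence of the marks and the counting process is independence of the generated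
  sigma-algebras; \<^const>\<open>prob_space.indep_var\<close> would force both to have the same value type.
\<close>

definition purchase_process ::
  "'a measure \<Rightarrow> (real \<Rightarrow> real) \<Rightarrow> (real \<Rightarrow> real) \<Rightarrow> (real \<Rightarrow> 'a \<Rightarrow> real) \<Rightarrow> bool" where
  "purchase_process M F G A \<longleftrightarrow>
     prob_space M \<and> admissible_df F \<and> admissible_df G \<and>
     (\<exists>\<xi> T. iid_nonneg M F \<xi> \<and> iid_nonneg M G T \<and>
        prob_space.indep_set M
          (sets (vimage_algebra (space M) (\<lambda>\<omega> i. \<xi> i \<omega>) (\<Pi>\<^sub>M i\<in>UNIV. borel)))
          (sets (vimage_algebra (space M) (\<lambda>\<omega>. \<lambda>u\<in>{0..}. renewal_count T u \<omega>)
             (\<Pi>\<^sub>M u\<in>{0..}. count_space UNIV))) \<and>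
        (\<forall>u\<ge>0. \<forall>\<omega>\<in>space M. A u \<omega> = (\<Sum>i<renewal_count T u \<omega>. \<xi> i \<omega>)))"

section \<open>Laws of processes, balances and the objective\<close>

definition process_law :: "'a measure \<Rightarrow> (real \<Rightarrow> 'a \<Rightarrow> real) \<Rightarrow> (real \<Rightarrow> real) measure" where
  "process_law M X = distr M (\<Pi>\<^sub>M u\<in>{0..}. borel) (\<lambda>\<omega>. \<lambda>u\<in>{0..}. X u \<omega>)"

text \<open>
  A law on the product space determines path functionals such as the balance below only
  together with a path regularity condition.
\<close>

definition right_continuous_process :: "'a measure \<Rightarrow> (real \<Rightarrow> 'a \<Rightarrow> real) \<Rightarrow> bool" where
  "right_continuous_process M X \<longleftrightarrow>
     (\<forall>u\<ge>0. X u \<in> borel_measurable M) \<and>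
     (AE \<omega> in M. \<forall>u\<ge>0. continuous (at_right u) (\<lambda>v. X v \<omega>))"

definition balance :: "(real \<Rightarrow> 'a \<Rightarrow> real) \<Rightarrow> real \<Rightarrow> real \<Rightarrow> 'a \<Rightarrow> real" where
  "balance A l t \<omega> = Sup {A u \<omega> | u. 0 \<le> u \<and> u \<le> t \<and> A u \<omega> \<le> l}"

definition objective ::
  "'a measure \<Rightarrow> (real \<Rightarrow> 'a \<Rightarrow> real) \<Rightarrow> real \<Rightarrow> real \<Rightarrow> real \<Rightarrow> real \<Rightarrow> real" where
  "objective M A \<gamma> \<nu> t l = \<gamma> * prob_space.expectation M (balance A l t) - \<nu> * l"

text \<open>
  Rescaling by \<open>\<alpha>\<close> turns the problem for \<open>A'\<close> over \<open>\<Lambda>\<close> into the problem for \<open>A\<close> over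
  \<open>{l / \<alpha> | l \<in> \<Lambda>}\<close>, so the maximiser over \<open>\<Lambda>\<close> scales only if no \<open>l / \<alpha>\<close> outside \<open>\<Lambda>\<close> does at
  least as well. For instance, let all marks and inter-event times be 1, \<open>t = 4\<close>, \<open>\<gamma> = 1\<close>,
  \<open>\<nu> = 1/2\<close>, so that the objective for \<open>A\<close> is \<open>min 4 \<lfloor>l\<rfloor> - l/2\<close>; with \<open>\<alpha> = 2\<close> and
  \<open>\<Lambda> = [6, 12]\<close> the unique maximisers are 6 for \<open>A\<close> and 8, not 12, for \<open>2 A\<close>.
\<close>

end

theory Submission
  imports Defs
begin

text \<open>
  The balance is not a measurable functional on the product space: a right-continuous path may
  touch the level \<open>l\<close> at a single irrational time. But on a path whose values do not accumulate
  at \<open>l\<close> from above, right-continuity lets one restrict the supremum to a countable set of times.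
  Purchase processes have this gap above \<open>l\<close>, because their values are partial sums of
  non-negative marks, and the gap at countably many times is a property of the law, so \<open>A'\<close>
  inherits it almost surely. Hence the balances of \<open>A'\<close> and \<open>\<alpha> A\<close> have the same expectation and
  the objective for \<open>A'\<close> at \<open>l\<close> is \<open>\<alpha>\<close> times the objective for \<open>A\<close> at \<open>l / \<alpha>\<close>.
\<close>

section \<open>Sampling the balance at countably many times\<close>

text \<open>The endpoint is included separately: it may be irrational, and no rational of the window
  lies to its right.\<close>

definition sample_times :: "real \<Rightarrow> real set" where
  "sample_times t = insert t (\<rat> \<inter> {0..t})"

text \<open>Putting 0 for values above \<open>l\<close> gives all paths the same index set and, for
  \<open>l > 0\<close>, keeps every term at most \<open>l\<close>.\<close>

definition sampled_balance :: "real \<Rightarrow> real \<Rightarrow> (real \<Rightarrow> real) \<Rightarrow> real" where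
  "sampled_balance l t x = (SUP q\<in>sample_times t. if x q \<le> l then x q else 0)"

text \<open>Gaps of size \<open>inverse (Suc n)\<close> at countably many times make this a
  measurable condition. Starting at 0 makes the default 0 of \<open>sampled_balance\<close> a true
  value of the path.\<close>

definition gap_above :: "real \<Rightarrow> real \<Rightarrow> (real \<Rightarrow> real) \<Rightarrow> bool" where
  "gap_above l t x \<longleftrightarrow>
     x 0 = 0 \<and> (\<exists>n::nat. \<forall>q\<in>sample_times t. x q < l + inverse (Suc n) \<longrightarrow> x q \<le> l)"

lemma countable_sample_times: "countable (sample_times t)"
  by (auto simp: sample_times_def intro: countable_subset[OF _ countable_rat])

lemma sample_times_nonneg: "0 < t \<Longrightarrow> q \<in> sample_times t \<Longrightarrow> 0 \<le> q"
  by (auto simp: sample_times_def)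

lemma measurable_sampled_balance:
  assumes "0 < t" "0 < l"
  shows "sampled_balance l t \<in> borel_measurable (\<Pi>\<^sub>M u\<in>{0..}. borel)"
  unfolding sampled_balance_def
proof (rule borel_measurable_cSUP[OF countable_sample_times])
  fix q assume "q \<in> sample_times t"
  then have [measurable]: "(\<lambda>x. x q) \<in> borel_measurable (\<Pi>\<^sub>M u\<in>{0::real..}. (borel :: real measure))"
    using sample_times_nonneg[OF assms(1)] by (intro measurable_component_singleton) auto
  show "(\<lambda>x. if x q \<le> l then x q else 0) \<in> borel_measurable (\<Pi>\<^sub>M u\<in>{0::real..}. (borel :: real measure))"
    by measurable
next
  fix x :: "real \<Rightarrow> real"
  show "bdd_above ((\<lambda>q. if x q \<le> l then x q else 0) ` sample_times t)"
    using assms by (intro bdd_aboveI[where M = l]) auto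
qed

lemma pred_gap_above:
  assumes "0 < t"
  shows "Measurable.pred (\<Pi>\<^sub>M u\<in>{0..}. borel) (gap_above l t)"
proof -
  have [measurable]: "(\<lambda>x. x q) \<in> borel_measurable (\<Pi>\<^sub>M u\<in>{0::real..}. (borel :: real measure))"
    if "0 \<le> q" for q
    using that by (intro measurable_component_singleton) auto
  have [measurable]: "Measurable.pred (\<Pi>\<^sub>M u\<in>{0::real..}. (borel :: real measure))
      (\<lambda>x. \<forall>q\<in>sample_times t. x q < l + inverse (Suc n) \<longrightarrow> x q \<le> l)" for n :: nat
  proof (rule measurable_pred_countable(1)[OF countable_sample_times])
    fix q assume "q \<in> sample_times t"
    then have [simp]: "0 \<le> q" using sample_times_nonneg[OF assms] by auto
    show "Measurable.pred (\<Pi>\<^sub>M u\<in>{0::real..}. (borel :: real measure))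
      (\<lambda>x. x q < l + inverse (Suc n) \<longrightarrow> x q \<le> l)"
      by measurable
  qed
  show ?thesis unfolding gap_above_def by measurable
qed

lemma balance_eq_sampled_balance:
  assumes "0 < t" "0 < l"
    and rc: "\<And>u. 0 \<le> u \<Longrightarrow> continuous (at_right u) (\<lambda>v. X v \<omega>)"
    and gap: "gap_above l t (\<lambda>u. X u \<omega>)"
  shows "balance X l t \<omega> = sampled_balance l t (\<lambda>u. X u \<omega>)"
proof -
  let ?S = "{X u \<omega> | u. 0 \<le> u \<and> u \<le> t \<and> X u \<omega> \<le> l}"
  let ?f = "\<lambda>q. if X q \<omega> \<le> l then X q \<omega> else 0"
  from gap obtain n :: nat where X0: "X 0 \<omega> = 0"
    and n: "\<And>q. q \<in> sample_times t \<Longrightarrow> X q \<omega> < l + inverse (Suc n) \<Longrightarrow> X q \<omega> \<le> l"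
    by (auto simp: gap_above_def)
  have zero: "0 \<in> ?S" using assms X0 by force
  have bS: "bdd_above ?S" by (intro bdd_aboveI[where M = l]) auto
  have bf: "bdd_above (?f ` sample_times t)"
    using assms by (intro bdd_aboveI[where M = l]) auto
  have "Sup ?S \<le> Sup (?f ` sample_times t)"
  proof (rule cSup_least)
    show "?S \<noteq> {}" using zero by blast
    fix y assume "y \<in> ?S"
    then obtain u where u: "0 \<le> u" "u \<le> t" "X u \<omega> \<le> l" "y = X u \<omega>" by blast
    show "y \<le> Sup (?f ` sample_times t)"
    proof (cases "u = t")
      case True
      then have "y \<in> ?f ` sample_times t" using u by (auto simp: sample_times_def)
      then show ?thesis using bf by (rule cSup_upper)
    next
      case False
      show ?thesis
      proof (rule field_le_epsilon)
        fix e :: real assume "0 < e"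
        \<comment> \<open>Accuracy \<open>e\<close> gives the estimate; accuracy
          \<open>inverse (Suc n)\<close> keeps \<open>X q \<omega>\<close> below
          \<open>l + inverse (Suc n)\<close>, so the gap forces it down to at most
          \<open>l\<close>.\<close>
        define d where "d = min e (inverse (Suc n))"
        have "0 < d" using \<open>0 < e\<close> by (simp add: d_def)
        have "((\<lambda>v. X v \<omega>) \<longlongrightarrow> X u \<omega>) (at_right u)"
          using rc[OF u(1)] by (simp add: continuous_within)
        then have "\<forall>\<^sub>F v in at_right u. dist (X v \<omega>) (X u \<omega>) < d"
          using \<open>0 < d\<close> by (rule tendstoD)
        moreover have "\<forall>\<^sub>F v in at_right u. v \<in> {u<..<t}"
          using False u by (intro eventually_at_right_real) auto
        ultimately have "\<forall>\<^sub>F v in at_right u. dist (X v \<omega>) (X u \<omega>) < d \<and> v < t"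
          by eventually_elim auto
        then obtain b where b: "b > u" "\<And>v. u < v \<Longrightarrow> v < b \<Longrightarrow> dist (X v \<omega>) (X u \<omega>) < d \<and> v < t"
          by (auto simp: eventually_at_right_field)
        obtain q where q: "q \<in> \<rat>" "u < q" "q < b" using Rats_dense_in_real[OF b(1)] by blast
        have qS: "q \<in> sample_times t" using q b(2)[of q] u by (auto simp: sample_times_def)
        have close: "\<bar>X q \<omega> - X u \<omega>\<bar> < d" using b(2)[of q] q by (simp add: dist_real_def)
        have "X q \<omega> < l + inverse (Suc n)" using close u(3) unfolding d_def by linarith
        then have "X q \<omega> \<le> l" using n qS by blast
        then have "X q \<omega> \<in> ?f ` sample_times t" using qS by auto
        then have "X q \<omega> \<le> Sup (?f ` sample_times t)" using bf by (rule cSup_upper)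
        then show "y \<le> Sup (?f ` sample_times t) + e" using close u(4) unfolding d_def by linarith
      qed
    qed
  qed
  moreover have "Sup (?f ` sample_times t) \<le> Sup ?S"
  proof (rule cSup_subset_mono[OF _ bS])
    show "?f ` sample_times t \<noteq> {}" by (auto simp: sample_times_def)
    \<comment> \<open>A sampled term is either a path value at most \<open>l\<close> or 0, the value
      at time 0.\<close>
    show "?f ` sample_times t \<subseteq> ?S"
    proof (rule image_subsetI)
      fix q assume "q \<in> sample_times t"
      then have "0 \<le> q" "q \<le> t" using assms(1) by (auto simp: sample_times_def)
      then show "?f q \<in> ?S" using zero by auto
    qed
  qed
  ultimately show ?thesis by (simp add: balance_def sampled_balance_def)
qed

section \<open>Passing to the law on path space\<close>

text \<open>\<open>process_law\<close> is the law of the path cut to nonnegative times; all sample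
  times are nonnegative, so the cut is invisible.\<close>

lemma sampled_balance_restrict:
  "0 < t \<Longrightarrow> sampled_balance l t (restrict x {0..}) = sampled_balance l t x"
  unfolding sampled_balance_def
  by (intro SUP_cong) (auto dest: sample_times_nonneg)

lemma gap_above_restrict: "0 < t \<Longrightarrow> gap_above l t (restrict x {0..}) = gap_above l t x"
  unfolding gap_above_def by (auto dest: sample_times_nonneg)

lemma measurable_path:
  assumes "\<And>u. 0 \<le> u \<Longrightarrow> X u \<in> borel_measurable M"
  shows "(\<lambda>\<omega>. \<lambda>u\<in>{0..}. X u \<omega>) \<in> measurable M (\<Pi>\<^sub>M u\<in>{0::real..}. (borel :: real measure))"
  using assms by (intro measurable_restrict) auto

lemma integral_process_law:
  assumes "\<And>u. 0 \<le> u \<Longrightarrow> X u \<in> borel_measurable M" "0 < t" "0 < l"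
  shows "integral\<^sup>L (process_law M X) (sampled_balance l t) =
    (\<integral>\<omega>. sampled_balance l t (\<lambda>u. X u \<omega>) \<partial>M)"
  unfolding process_law_def
  using assms by (subst integral_distr[OF measurable_path measurable_sampled_balance])
    (auto simp: sampled_balance_restrict)

lemma AE_process_law_gap_above:
  assumes "\<And>u. 0 \<le> u \<Longrightarrow> X u \<in> borel_measurable M" "0 < t"
  shows "(AE x in process_law M X. gap_above l t x) \<longleftrightarrow>
    (AE \<omega> in M. gap_above l t (\<lambda>u. X u \<omega>))"
  unfolding process_law_def
  using assms pred_gap_above[OF assms(2)]
  by (subst AE_distr_iff[OF measurable_path]) (auto simp: gap_above_restrict)

lemma prob_process_law:
  assumes "\<And>u. 0 \<le> u \<Longrightarrow> X u \<in> borel_measurable M" "0 \<le> t"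
  shows "measure (process_law M X) {x \<in> space (\<Pi>\<^sub>M u\<in>{0..}. borel). c < x t} = \<P>(\<omega> in M. c < X t \<omega>)"
proof -
  have [measurable]: "(\<lambda>x. x t) \<in> borel_measurable (\<Pi>\<^sub>M u\<in>{0::real..}. (borel :: real measure))"
    using assms(2) by (intro measurable_component_singleton) auto
  have "{x \<in> space (\<Pi>\<^sub>M u\<in>{0::real..}. (borel :: real measure)). c < x t}
      \<in> sets (\<Pi>\<^sub>M u\<in>{0..}. borel)"
    by measurable
  then show ?thesis
    unfolding process_law_def using assms
    by (subst measure_distr[OF measurable_path])
      (auto intro!: arg_cong[where f = "measure M"] simp: space_PiM)
qed

section \<open>Path properties of purchase processes\<close>

text \<open>
  This also holds beyond an accumulation point of the epochs, where the count is constantly the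
  junk value 0, so no almost sure statement about the renewal process is needed.
\<close>

lemma renewal_count_locally_constant:
  assumes "\<And>i. 0 \<le> T i \<omega>"
  shows "\<forall>\<^sub>F v in at_right u. renewal_count T v \<omega> = renewal_count T u \<omega>"
proof -
  define S where "S n = (\<Sum>i\<le>n. T i \<omega>)" for n
  have mono: "S m \<le> S n" if "m \<le> n" for m n
    unfolding S_def using that assms by (intro sum_mono2) auto
  have gt: "\<forall>\<^sub>F v in at_right u. u < v" by (auto simp: eventually_at_right_less)
  \<comment> \<open>These cases are exhaustive: if some partial sum is positive and none exceeds
    \<open>u\<close>, monotonicity puts all later ones in \<open>{0<..u}\<close>.\<close>
  consider (inf) "infinite {n. S n \<in> {0<..u}}" | (none) "\<And>n. S n \<le> 0"
    | (ex) m where "u < S m"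
  proof -
    have "infinite {n. S n \<in> {0<..u}}" if m: "0 < S m" and le: "\<And>n. S n \<le> u" for m
    proof -
      have "{m..} \<subseteq> {n. S n \<in> {0<..u}}" using mono[of m] m le by force
      then show ?thesis using infinite_Ici infinite_super by blast
    qed
    then show thesis using that by (meson not_le)
  qed
  then show ?thesis
  proof cases
    \<comment> \<open>More time only adds indices, so both sets are infinite and both cardinalities
      are 0.\<close>
    case inf
    from gt show ?thesis
    proof eventually_elim
      case (elim v)
      then have "{n. S n \<in> {0<..u}} \<subseteq> {n. S n \<in> {0<..v}}" by auto
      then have "infinite {n. S n \<in> {0<..v}}" using inf infinite_super by blast
      then show ?case using inf by (simp add: renewal_count_def S_def)
    qed
  next
    case none
    then have "{n. S n \<in> {0<..v}} = {}" for v by (force simp: not_less)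
    then have "renewal_count T v \<omega> = 0" for v
      unfolding renewal_count_def S_def[symmetric] by (simp only: card.empty)
    then show ?thesis by simp
  next
    case ex
    \<comment> \<open>\<open>S k\<close> is the first epoch beyond \<open>u\<close>; no new epoch is
      met before it.\<close>
    define k where "k = (LEAST m. u < S m)"
    have k: "u < S k" unfolding k_def using ex by (rule LeastI)
    have "\<forall>\<^sub>F v in at_right u. v \<in> {u<..<S k}" using k by (rule eventually_at_right_real)
    then show ?thesis
    proof eventually_elim
      case (elim v)
      have "S n \<le> u" if "S n \<le> v" for n
      proof -
        have "n < k" using that elim mono[of k n] by (force simp: not_less)
        then show ?thesis using not_less_Least[of n "\<lambda>m. u < S m"] by (simp add: k_def)
      qed
      then have "{n. S n \<in> {0<..v}} = {n. S n \<in> {0<..u}}" using elim by force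
      then show ?case unfolding renewal_count_def S_def[symmetric] by simp
    qed
  qed
qed

text \<open>The path properties hold at every point of \<open>space M\<close>, since marks and
  inter-event times are nonnegative everywhere. The factor \<open>c\<close> is there because the law
  of \<open>A'\<close> is that of \<open>\<alpha>\<close> times \<open>A\<close>.\<close>

lemma purchase_process_paths:
  assumes "purchase_process M F G A" "0 < c"
  shows purchase_process_measurable: "0 \<le> u \<Longrightarrow> (\<lambda>\<omega>. c * A u \<omega>) \<in> borel_measurable M"
    and purchase_process_right_continuous:
      "0 \<le> u \<Longrightarrow> \<omega> \<in> space M \<Longrightarrow> continuous (at_right u) (\<lambda>v. c * A v \<omega>)"
    and purchase_process_gap_above:
      "0 < t \<Longrightarrow> 0 < l \<Longrightarrow> \<omega> \<in> space M \<Longrightarrow> gap_above l t (\<lambda>u. c * A u \<omega>)"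
proof -
  from assms(1) interpret prob_space M by (simp add: purchase_process_def)
  from assms(1) obtain \<xi> T where iid: "iid_nonneg M F \<xi>" "iid_nonneg M G T"
    and A: "\<And>u \<omega>. 0 \<le> u \<Longrightarrow> \<omega> \<in> space M \<Longrightarrow> A u \<omega> = (\<Sum>i<renewal_count T u \<omega>. \<xi> i \<omega>)"
    unfolding purchase_process_def by blast
  have [measurable]: "\<xi> i \<in> borel_measurable M" "T i \<in> borel_measurable M" for i
    using iid by (auto simp: iid_nonneg_def indep_vars_def)
  have nonneg: "0 \<le> \<xi> i \<omega>" "0 \<le> T i \<omega>" if "\<omega> \<in> space M" for i \<omega>
    using iid that by (auto simp: iid_nonneg_def)
  show "(\<lambda>\<omega>. c * A u \<omega>) \<in> borel_measurable M" if u: "0 \<le> u" for u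
  proof -
    have [measurable]: "renewal_count T u \<in> measurable M (count_space UNIV)"
      unfolding renewal_count_def by measurable
    \<comment> \<open>The number of summands is random; splitting over its countably many values
      leaves fixed finite sums.\<close>
    have "(\<lambda>\<omega>. \<Sum>i<renewal_count T u \<omega>. \<xi> i \<omega>) \<in> borel_measurable M"
      by (rule measurable_compose_countable[where g = "renewal_count T u"]) measurable
    then have "A u \<in> borel_measurable M"
      using A[OF u] by (subst measurable_cong) auto
    then show ?thesis by measurable
  qed
  show "continuous (at_right u) (\<lambda>v. c * A v \<omega>)" if u: "0 \<le> u" and \<omega>: "\<omega> \<in> space M" for u \<omega>
  proof -
    have "\<forall>\<^sub>F v in at_right u. u < v" by (auto simp: eventually_at_right_less)
    with renewal_count_locally_constant[of T \<omega> u, OF nonneg(2)[OF \<omega>]]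
    have "\<forall>\<^sub>F v in at_right u. c * A v \<omega> = c * A u \<omega>"
      by eventually_elim (use A u \<omega> in auto)
    then show ?thesis unfolding continuous_within by (rule tendsto_eventually)
  qed
  show "gap_above l t (\<lambda>u. c * A u \<omega>)" if "0 < t" "0 < l" and \<omega>: "\<omega> \<in> space M" for t l \<omega>
  proof -
    \<comment> \<open>Every path value is some \<open>s m\<close>, and these are nondecreasing, so
      the first one above \<open>l\<close> determines the gap; if there is none, any
      \<open>n\<close> works.\<close>
    define s where "s m = c * (\<Sum>i<m. \<xi> i \<omega>)" for m
    have mono: "s m \<le> s n" if "m \<le> n" for m n
      unfolding s_def using that nonneg(1)[OF \<omega>] assms(2)
      by (intro mult_left_mono sum_mono2) auto
    have cA: "c * A u \<omega> = s (renewal_count T u \<omega>)" if "0 \<le> u" for u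
      using A[OF that \<omega>] by (simp add: s_def)
    \<comment> \<open>The interval \<open>{0<..0}\<close> is empty, so epochs at time 0 are not
      counted.\<close>
    have "renewal_count T 0 \<omega> = 0" by (simp add: renewal_count_def)
    then have "c * A 0 \<omega> = 0" by (simp add: cA s_def)
    moreover have "\<exists>n::nat. \<forall>m. s m < l + inverse (Suc n) \<longrightarrow> s m \<le> l"
    proof (cases "\<exists>m. l < s m")
      case True
      define k where "k = (LEAST m. l < s m)"
      have k: "l < s k" unfolding k_def using True by (rule LeastI_ex)
      then obtain n :: nat where n: "inverse (Suc n) < s k - l"
        using reals_Archimedean[of "s k - l"] by auto
      have "s m \<le> l" if "s m < l + inverse (Suc n)" for m
      proof -
        have "m < k" using that n mono[of k m] by (force simp: not_less)
        then show ?thesis using not_less_Least[of m "\<lambda>m. l < s m"] by (simp add: k_def)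
      qed
      then show ?thesis by blast
    qed (auto simp: not_less)
    ultimately show ?thesis
      unfolding gap_above_def using sample_times_nonneg[OF \<open>0 < t\<close>] by (auto simp: cA)
  qed
qed

section \<open>Scaling of the balance and of the objective\<close>

text \<open>Multiplication by \<open>c > 0\<close> is increasing and continuous, so it commutes with
  the supremum of a nonempty bounded set; \<open>A 0 \<omega> = 0\<close> and \<open>l > 0\<close>
  give nonemptiness.\<close>

lemma balance_scale:
  assumes "0 < c" "0 < l" "0 < t" "A 0 \<omega> = 0"
  shows "balance (\<lambda>u \<omega>. c * A u \<omega>) l t \<omega> = c * balance A (l / c) t \<omega>"
proof -
  let ?S = "{A u \<omega> | u. 0 \<le> u \<and> u \<le> t \<and> A u \<omega> \<le> l / c}"
  have "0 \<in> ?S" using assms by force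
  moreover have "bdd_above ?S" by (intro bdd_aboveI[where M = "l / c"]) auto
  moreover have "mono ((*) c)" using assms(1) by (intro monoI mult_left_mono) auto
  ultimately have "c * Sup ?S = (SUP y\<in>?S. c * y)"
    by (intro continuous_at_Sup_mono) (auto intro!: continuous_intros)
  also have "(*) c ` ?S = {c * A u \<omega> | u. 0 \<le> u \<and> u \<le> t \<and> c * A u \<omega> \<le> l}"
    using assms(1) by (auto simp: field_simps)
  finally show ?thesis by (simp add: balance_def)
qed

lemma objective_scale:
  assumes "0 < \<alpha>" "0 < t" "0 < l"
    and A: "purchase_process M F G A"
    and rc: "right_continuous_process M' A'"
    and law: "process_law M' A' = process_law M (\<lambda>u \<omega>. \<alpha> * A u \<omega>)"
    and meas: "balance A' l t \<in> borel_measurable M'"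
  shows "objective M' A' \<gamma> \<nu> t l = \<alpha> * objective M A \<gamma> \<nu> t (l / \<alpha>)"
proof -
  have m': "A' u \<in> borel_measurable M'" if "0 \<le> u" for u
    using rc that by (auto simp: right_continuous_process_def)
  note m = purchase_process_measurable[OF A assms(1)]
  note gap = purchase_process_gap_above[OF A assms(1) assms(2,3)]
  \<comment> \<open>The gap travels from \<open>\<alpha>\<close> times \<open>A\<close> up to the
    common law and back down to \<open>A'\<close>.\<close>
  have "AE \<omega> in M. gap_above l t (\<lambda>u. \<alpha> * A u \<omega>)" using gap by auto
  then have "AE x in process_law M' A'. gap_above l t x"
    unfolding law by (subst AE_process_law_gap_above[OF m assms(2)])
  then have "AE \<omega> in M'. gap_above l t (\<lambda>u. A' u \<omega>)"
    by (subst (asm) AE_process_law_gap_above[OF m' assms(2)])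
  moreover have "AE \<omega> in M'. \<forall>u\<ge>0. continuous (at_right u) (\<lambda>v. A' v \<omega>)"
    using rc by (auto simp: right_continuous_process_def)
  ultimately have eq: "AE \<omega> in M'. balance A' l t \<omega> = sampled_balance l t (\<lambda>u. A' u \<omega>)"
    by eventually_elim (rule balance_eq_sampled_balance[OF assms(2,3)], auto)
  have "(\<lambda>\<omega>. sampled_balance l t (\<lambda>u\<in>{0..}. A' u \<omega>)) \<in> borel_measurable M'"
    using measurable_path[OF m'] measurable_sampled_balance[OF assms(2,3)]
    by (rule measurable_compose)
  then have "(\<lambda>\<omega>. sampled_balance l t (\<lambda>u. A' u \<omega>)) \<in> borel_measurable M'"
    by (simp add: sampled_balance_restrict[OF assms(2)])
  \<comment> \<open>Almost sure equality transfers integrals between measurable functions; for the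
    balance of \<open>A'\<close>, whose paths are controlled only up to a null set, measurability is
    \<open>meas\<close>.\<close>
  from integral_cong_AE[OF meas this eq]
  have "integral\<^sup>L M' (balance A' l t) = integral\<^sup>L (process_law M' A') (sampled_balance l t)"
    by (simp add: integral_process_law[OF m' assms(2,3)])
  also have "\<dots> = (\<integral>\<omega>. sampled_balance l t (\<lambda>u. \<alpha> * A u \<omega>) \<partial>M)"
    unfolding law by (rule integral_process_law[OF m assms(2,3)])
  also have "\<dots> = (\<integral>\<omega>. \<alpha> * balance A (l / \<alpha>) t \<omega> \<partial>M)"
  \<comment> \<open>On \<open>M\<close> the path properties hold at every point, so the integrands
    agree pointwise.\<close>
  proof (rule Bochner_Integration.integral_cong[OF refl])
    fix \<omega> assume \<omega>: "\<omega> \<in> space M"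
    have "sampled_balance l t (\<lambda>u. \<alpha> * A u \<omega>) = balance (\<lambda>u \<omega>. \<alpha> * A u \<omega>) l t \<omega>"
      using purchase_process_right_continuous[OF A assms(1) _ \<omega>] gap[OF \<omega>]
      by (intro balance_eq_sampled_balance[OF assms(2,3), symmetric])
    also have "\<dots> = \<alpha> * balance A (l / \<alpha>) t \<omega>"
      using gap[OF \<omega>] assms by (intro balance_scale) (auto simp: gap_above_def)
    finally show "sampled_balance l t (\<lambda>u. \<alpha> * A u \<omega>) = \<alpha> * balance A (l / \<alpha>) t \<omega>" .
  qed
  \<comment> \<open>The cost scales as well:
    \<open>\<nu> * l = \<alpha> * (\<nu> * (l / \<alpha>))\<close>.\<close>
  finally show ?thesis
    using assms(1) by (simp add: objective_def field_simps)
qed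

section \<open>Transfer to the maximisers and the exceedance probability\<close>

text \<open>\<open>arg_max\<close> is a Hilbert choice, so uniqueness is what identifies the chosen
  point.\<close>

lemma arg_max_eqI:
  assumes "\<exists>!l. is_arg_max f P l" "is_arg_max f P l"
  shows "arg_max f P = l"
  using assms unfolding arg_max_def by (blast intro: some1_equality)

theorem proposition1:
  fixes M :: "'a measure" and M' :: "'b measure"
    and F G :: "real \<Rightarrow> real"
    and A :: "real \<Rightarrow> 'a \<Rightarrow> real" and A' :: "real \<Rightarrow> 'b \<Rightarrow> real"
    and \<alpha> \<gamma> \<nu> t l_hat l_hat' :: real and \<Lambda> :: "real set"
  assumes "0 < \<alpha>" and "0 < t" and "0 < \<gamma>" and "0 < \<nu>" and "\<Lambda> \<subseteq> {0<..}"
    and "purchase_process M F G A"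
    and "prob_space M'" and "right_continuous_process M' A'"
    and "process_law M' A' = process_law M (\<lambda>u \<omega>. \<alpha> * A u \<omega>)"
    and "\<forall>l\<in>\<Lambda>. balance A' l t \<in> borel_measurable M'"
    and "\<exists>!l. is_arg_max (objective M A \<gamma> \<nu> t) (\<lambda>l. l \<in> \<Lambda>) l"
    and "l_hat = arg_max (objective M A \<gamma> \<nu> t) (\<lambda>l. l \<in> \<Lambda>)"
    and "l_hat' = arg_max (objective M' A' \<gamma> \<nu> t) (\<lambda>l. l \<in> \<Lambda>)"
    and "\<alpha> * l_hat \<in> \<Lambda>"
    and "\<forall>l\<in>\<Lambda>. l / \<alpha> \<in> \<Lambda> \<or>
           objective M A \<gamma> \<nu> t (l / \<alpha>) < objective M A \<gamma> \<nu> t l_hat"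
  shows "(\<exists>!l. is_arg_max (objective M' A' \<gamma> \<nu> t) (\<lambda>l. l \<in> \<Lambda>) l) \<and>
         l_hat' = \<alpha> * l_hat \<and>
         \<P>(\<omega> in M'. A' t \<omega> > l_hat') = \<P>(\<omega> in M. A t \<omega> > l_hat)"
proof -
  let ?f = "objective M A \<gamma> \<nu> t" and ?f' = "objective M' A' \<gamma> \<nu> t"
  have scale: "?f' l = \<alpha> * ?f (l / \<alpha>)" if "l \<in> \<Lambda>" for l
    using that assms by (intro objective_scale[where F = F and G = G]) auto
  have max: "is_arg_max ?f (\<lambda>l. l \<in> \<Lambda>) l_hat"
    using assms(11,12) arg_max_eqI by metis
  \<comment> \<open>Strictness comes from uniqueness: a point doing at least as well as
    \<open>l_hat\<close> would itself be a maximiser.\<close>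
  have less: "?f l < ?f l_hat" if "l \<in> \<Lambda>" "l \<noteq> l_hat" for l
  proof (rule ccontr)
    assume "\<not> ?f l < ?f l_hat"
    then have "is_arg_max ?f (\<lambda>l. l \<in> \<Lambda>) l"
      using max that(1) unfolding is_arg_max_def by (meson le_less_trans not_le)
    then show False using assms(11) max that(2) by blast
  qed
  have less': "?f' l < ?f' (\<alpha> * l_hat)" if l: "l \<in> \<Lambda>" "l \<noteq> \<alpha> * l_hat" for l
  proof -
    have "l / \<alpha> \<noteq> l_hat" using l(2) assms(1) by auto
    \<comment> \<open>Inside \<open>\<Lambda>\<close> the point \<open>l / \<alpha>\<close> is
      strictly worse by uniqueness; outside, this is the assumed strict inequality.\<close>
    then have "?f (l / \<alpha>) < ?f l_hat" using assms(15) l(1) less by blast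
    then show ?thesis using scale[OF l(1)] scale[OF assms(14)] assms(1) by simp
  qed
  have max': "is_arg_max ?f' (\<lambda>l. l \<in> \<Lambda>) (\<alpha> * l_hat)"
    unfolding is_arg_max_def using assms(14) less' by (metis less_asym)
  have uniq: "\<exists>!l. is_arg_max ?f' (\<lambda>l. l \<in> \<Lambda>) l"
    using max' less' assms(14) unfolding is_arg_max_def by metis
  have l': "l_hat' = \<alpha> * l_hat" using arg_max_eqI[OF uniq max'] assms(13) by simp
  \<comment> \<open>The event depends on the coordinate \<open>t\<close> alone, so equal laws give
    it equal probability; the positive factor \<open>\<alpha>\<close> cancels afterwards.\<close>
  have "\<P>(\<omega> in M'. A' t \<omega> > l_hat') = \<P>(\<omega> in M. \<alpha> * A t \<omega> > \<alpha> * l_hat)"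
    using prob_process_law[where X = A' and M = M' and t = t and c = "\<alpha> * l_hat"] assms(2,8)
      prob_process_law[OF purchase_process_measurable[OF assms(6,1)], where t = t and c = "\<alpha> * l_hat"]
    by (simp add: assms(9) l' right_continuous_process_def)
  then show ?thesis using uniq l' assms(1) by simp
qed

end
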